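(* Let $G$ be a pair of $d$-dimensional butterflies and let $0\le m\le d$. For every set $A$ of input nodes and every set $B$ of output nodes of $G$ with $|A|=|B|=2^{m}$, there exist node-disjoint paths from $A$ to $B$. (In other words, $G$ is a $2^m$-concentrator.)
   Context: The standard $d$-dimensional butterfly is the directed graph whose nodes are the pairs $(i,b)$ with $i\in\{0,\dots,d\}$ (the layer) and $b\in\{0,1\}^d$ (the label). For $1\le i\le d$ there is a directed edge from $(i-1,b)$ to each of the two nodes $(i,b')$ where $b'$ agrees with $b$ except possibly in coordinate $i$. Layer-$0$ nodes are inputs and layer-$d$ nodes are outputs. A pair of $d$-dimensional butterflies is formed from two directed graphs $G_1$ and $G_2$, each isomorphic to the standard $d$-dimensional butterfly (not necessarily identical to each other). The output nodes of $G_1$ are identified with the input nodes of $G_2$ via a bijection. The result has layers $0,\dots,2d$; its inputs are the inputs of $G_1$ and its outputs are the outputs of $G_2$. For a set $A$ of inputs and a set $B$ of outputs with $|A|=|B|$, "node-disjoint paths from $A$ to $B$" means $|A|$ directed paths, each from a node of $A$ to a node of $B$, no two sharing a node and none repeating a node. Hence each node of $A\cup B$ is an endpoint of exactly one path. A graph is a $k$-concentrator if such paths exist for all $A$, $B$ with $|A|=|B|=k$. *)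

theory Defs
  imports "Graph_Theory.Graph_Theory" "HOL-Library.FuncSet"
begin

section \<open>Butterflies\<close>

type_synonym bnode = "nat \<times> (nat \<Rightarrow> nat)"

definition labels :: "nat \<Rightarrow> (nat \<Rightarrow> nat) set" where
  "labels d = {1..d} \<rightarrow>\<^sub>E {0, 1}"

definition layer :: "nat \<Rightarrow> nat \<Rightarrow> bnode set" where
  "layer d i = {i} \<times> labels d"

definition butterfly :: "nat \<Rightarrow> (bnode, bnode \<times> bnode) pre_digraph" where
  "butterfly d = \<lparr>
     verts = (\<Union>i\<in>{0..d}. layer d i),
     arcs = {((i - 1, b), (i, b')) | i b b'.
       1 \<le> i \<and> i \<le> d \<and> b \<in> labels d \<and> b' \<in> labels d \<and> (\<forall>j\<in>{1..d} - {i}. b' j = b j)},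
     tail = fst,
     head = snd \<rparr>"

lemma wf_digraph_butterfly: "wf_digraph (butterfly d)"
  by unfold_locales (auto simp: butterfly_def layer_def)

text \<open>The isomorphism determines which nodes of the copy are inputs and which are outputs.\<close>

definition butterfly_copy :: "nat \<Rightarrow> ('a, 'e) pre_digraph \<Rightarrow> 'a set \<Rightarrow> 'a set \<Rightarrow> bool" where
  "butterfly_copy d G ins outs \<longleftrightarrow>
     (\<exists>f. pre_digraph.digraph_isomorphism (butterfly d) f \<and> G = app_iso f (butterfly d) \<and>
          ins = iso_verts f ` layer d 0 \<and> outs = iso_verts f ` layer d d)"


section \<open>Pairs of butterflies\<close>

text \<open>
  Gluing the disjoint union of two digraphs along a map \<open>\<phi>\<close> that is injective on a set \<open>S\<close> of
  nodes of the first one: a node \<open>\<phi> s\<close> of the second digraph, with \<open>s \<in> S\<close>, is represented by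
  \<open>Inl s\<close>, every other node \<open>v\<close> of it by \<open>Inr v\<close>.
\<close>

definition glue_node :: "('a \<Rightarrow> 'b) \<Rightarrow> 'a set \<Rightarrow> 'b \<Rightarrow> 'a + 'b" where
  "glue_node \<phi> S v = (if v \<in> \<phi> ` S then Inl (the_inv_into S \<phi> v) else Inr v)"

definition glue ::
  "('a \<Rightarrow> 'b) \<Rightarrow> 'a set \<Rightarrow> ('a, 'e) pre_digraph \<Rightarrow> ('b, 'f) pre_digraph \<Rightarrow> ('a + 'b, 'e + 'f) pre_digraph"
where
  "glue \<phi> S G1 G2 = \<lparr>
     verts = Inl ` verts G1 \<union> glue_node \<phi> S ` verts G2,
     arcs = arcs G1 <+> arcs G2,
     tail = case_sum (\<lambda>e. Inl (tail G1 e)) (\<lambda>e. glue_node \<phi> S (tail G2 e)),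
     head = case_sum (\<lambda>e. Inl (head G1 e)) (\<lambda>e. glue_node \<phi> S (head G2 e)) \<rparr>"

definition butterfly_pair ::
  "nat \<Rightarrow> ('a + 'b, 'e + 'f) pre_digraph \<Rightarrow> ('a + 'b) set \<Rightarrow> ('a + 'b) set \<Rightarrow> bool"
where
  "butterfly_pair d G ins outs \<longleftrightarrow>
     (\<exists>(G1 :: ('a, 'e) pre_digraph) ins1 outs1 (G2 :: ('b, 'f) pre_digraph) ins2 outs2 \<phi>.
        butterfly_copy d G1 ins1 outs1 \<and> butterfly_copy d G2 ins2 outs2 \<and>
        bij_betw \<phi> outs1 ins2 \<and>
        G = glue \<phi> outs1 G1 G2 \<and> ins = Inl ` ins1 \<and> outs = glue_node \<phi> outs1 ` outs2)"


section \<open>Node-disjoint paths\<close>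

definition node_disjoint_paths :: "('v, 'e) pre_digraph \<Rightarrow> 'v set \<Rightarrow> 'v set \<Rightarrow> bool" where
  "node_disjoint_paths G A B \<longleftrightarrow>
     (\<exists>P. finite P \<and> card P = card A \<and>
          (\<forall>p\<in>P. vpath p G \<and> hd p \<in> A \<and> last p \<in> B) \<and>
          (\<forall>p\<in>P. \<forall>q\<in>P. p \<noteq> q \<longrightarrow> set p \<inter> set q = {}))"

definition concentrator :: "nat \<Rightarrow> ('v, 'e) pre_digraph \<Rightarrow> 'v set \<Rightarrow> 'v set \<Rightarrow> bool" where
  "concentrator k G ins outs \<longleftrightarrow>
     (\<forall>A B. A \<subseteq> ins \<and> B \<subseteq> outs \<and> card A = k \<and> card B = k \<longrightarrow> node_disjoint_paths G A B)"

end

theory Submission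
  imports Defs
begin

text \<open>
  In a butterfly there is exactly one path from a given input to a given output. Hence an input
  \<open>a \<in> A\<close>, a middle node \<open>c\<close> and an output \<open>b \<in> B\<close> determine one path from \<open>a\<close> through \<open>c\<close> to \<open>b\<close>.
  With \<open>k = |A| = |B|\<close> and \<open>N = 2^d\<close> these are \<open>k * N * k\<close> paths. A node in layer \<open>i\<close> of the first
  butterfly is reached from \<open>2^i\<close> inputs and reaches \<open>2^(d-i)\<close> middle nodes, so it lies on at most
  \<open>N * k\<close> of the paths; the second butterfly is symmetric. Therefore a set of nodes meeting all
  paths from \<open>A\<close> to \<open>B\<close> has at least \<open>k\<close> elements, and Menger's theorem applies.
\<close>

section \<open>Menger's theorem\<close>

text \<open>The edges form a bare relation so that Menger's theorem can be proved by induction on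
  them. A single node is a walk even without edges; hence a separator of \<open>A\<close> and
  \<open>B\<close> must contain \<open>A \<inter> B\<close>.\<close>

definition walk :: "('v \<times> 'v) set \<Rightarrow> 'v list \<Rightarrow> bool" where
  "walk E p \<longleftrightarrow> p \<noteq> [] \<and> successively (\<lambda>u v. (u, v) \<in> E) p"

definition separates :: "('v \<times> 'v) set \<Rightarrow> 'v set \<Rightarrow> 'v set \<Rightarrow> 'v set \<Rightarrow> bool" where
  "separates E A B S \<longleftrightarrow> (\<forall>p. walk E p \<and> hd p \<in> A \<and> last p \<in> B \<longrightarrow> set p \<inter> S \<noteq> {})"

definition linkage :: "('v \<times> 'v) set \<Rightarrow> 'v set \<Rightarrow> 'v set \<Rightarrow> 'v list set \<Rightarrow> bool" where
  "linkage E A B P \<longleftrightarrow>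
     (\<forall>p\<in>P. walk E p \<and> distinct p \<and> hd p \<in> A \<and> last p \<in> B) \<and>
     (\<forall>p\<in>P. \<forall>q\<in>P. p \<noteq> q \<longrightarrow> set p \<inter> set q = {})"

lemma separatesD:
  assumes "separates E A B S" "walk E p" "hd p \<in> A" "last p \<in> B"
  obtains v where "v \<in> set p" "v \<in> S"
  using assms unfolding separates_def by blast

lemma linkageD:
  assumes "linkage E A B P" "p \<in> P"
  shows "walk E p" "distinct p" "hd p \<in> A" "last p \<in> B" "p \<noteq> []"
  using assms unfolding linkage_def walk_def by blast+

lemma linkage_eqI:
  assumes "linkage E A B P" "p \<in> P" "q \<in> P" "v \<in> set p" "v \<in> set q"
  shows "p = q"
  using assms unfolding linkage_def by blast

section \<open>Walks in an edge relation\<close>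

lemma walk_mono: "walk E p \<Longrightarrow> E \<subseteq> E' \<Longrightarrow> walk E' p"
  unfolding walk_def by (auto elim: successively_mono)

lemma walk_append:
  assumes "walk E p" "walk E q" "(last p, hd q) \<in> E"
  shows "walk E (p @ q)"
  using assms unfolding walk_def by (auto simp: successively_append_iff)

lemma walk_append_tl:
  assumes "walk E p" "walk E q" "last p = hd q"
  shows "walk E (p @ tl q)"
  using assms unfolding walk_def by (cases q) (auto simp: successively_append_iff successively_Cons)

lemma last_append_tl: "q \<noteq> [] \<Longrightarrow> last p = hd q \<Longrightarrow> last (p @ tl q) = last q"
  by (cases q) auto

lemma walk_prefix: "walk E (ys @ v # zs) \<Longrightarrow> walk E (ys @ [v])"
  unfolding walk_def by (auto simp: successively_append_iff)

lemma walk_suffix: "walk E (ys @ v # zs) \<Longrightarrow> walk E (v # zs)"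
  unfolding walk_def by (auto simp: successively_append_iff)

text \<open>Traversing \<open>(x, y)\<close> puts \<open>x\<close> before the last position. The
  last position is exempt, so the lemma covers walks cut off on reaching \<open>x\<close>.\<close>

lemma walk_delete_edge_tail:
  assumes "walk (insert (x, y) E) p" "x \<notin> set (butlast p)"
  shows "walk E p"
  using assms
proof (induction p)
  case (Cons a p)
  then show ?case by (cases p) (auto simp: walk_def)
qed (simp add: walk_def)

lemma walk_delete_edge_head:
  assumes "walk (insert (x, y) E) p" "y \<notin> set (tl p)"
  shows "walk E p"
  using assms
proof (induction p)
  case (Cons a p)
  then show ?case by (cases p) (auto simp: walk_def)
qed (simp add: walk_def)

section \<open>Separators after adding an edge\<close>

lemma separates_insert_tail:
  assumes "separates E A B S"
  shows "separates (insert (x, y) E) A B (insert x S)"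
  unfolding separates_def
proof (intro allI impI)
  fix p assume p: "walk (insert (x, y) E) p \<and> hd p \<in> A \<and> last p \<in> B"
  show "set p \<inter> insert x S \<noteq> {}"
  proof (cases "x \<in> set p")
    case False
    then have "walk E p" using p walk_delete_edge_tail[of x y E p] by (auto dest: in_set_butlastD)
    then show ?thesis using p assms unfolding separates_def by blast
  qed auto
qed

lemma separates_insert_head:
  assumes "separates E A B S"
  shows "separates (insert (x, y) E) A B (insert y S)"
  unfolding separates_def
proof (intro allI impI)
  fix p assume p: "walk (insert (x, y) E) p \<and> hd p \<in> A \<and> last p \<in> B"
  show "set p \<inter> insert y S \<noteq> {}"
  proof (cases "y \<in> set p")
    case False
    then have "walk E p" using p walk_delete_edge_head[of x y E p] by (cases p) auto
    then show ?thesis using p assms unfolding separates_def by blast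
  qed auto
qed

text \<open>Cut a walk at its first node in \<open>insert x S\<close>: the initial piece meets
  \<open>x\<close> at most at its end, so it avoids the new edge and \<open>T\<close> hits it
  already in \<open>E\<close>.\<close>

lemma separates_from_source_side:
  assumes S: "separates (insert (x, y) E) A B (insert x S)" and T: "separates E A (insert x S) T"
  shows "separates (insert (x, y) E) A B T"
  unfolding separates_def
proof (intro allI impI)
  fix p assume p: "walk (insert (x, y) E) p \<and> hd p \<in> A \<and> last p \<in> B"
  then have "\<exists>v\<in>set p. v \<in> insert x S" using S unfolding separates_def by blast
  then obtain ys v zs where ys: "p = ys @ v # zs" "v \<in> insert x S" "\<forall>u\<in>set ys. u \<notin> insert x S"
    using split_list_first_prop[of p "\<lambda>v. v \<in> insert x S"] by blast
  have "walk (insert (x, y) E) (ys @ [v])" using p ys(1) walk_prefix by metis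
  then have "walk E (ys @ [v])" using ys(3) walk_delete_edge_tail[of x y E "ys @ [v]"] by auto
  moreover have "hd (ys @ [v]) \<in> A" using p ys(1) by (cases ys) auto
  moreover have "last (ys @ [v]) \<in> insert x S" using ys(2) by simp
  ultimately have "set (ys @ [v]) \<inter> T \<noteq> {}" using T unfolding separates_def by blast
  then show "set p \<inter> T \<noteq> {}" using ys(1) by auto
qed

lemma separates_from_target_side:
  assumes S: "separates (insert (x, y) E) A B (insert y S)" and T: "separates E (insert y S) B T"
  shows "separates (insert (x, y) E) A B T"
  unfolding separates_def
proof (intro allI impI)
  fix p assume p: "walk (insert (x, y) E) p \<and> hd p \<in> A \<and> last p \<in> B"
  then have "\<exists>v\<in>set p. v \<in> insert y S" using S unfolding separates_def by blast
  then obtain ys v zs where ys: "p = ys @ v # zs" "v \<in> insert y S" "\<forall>u\<in>set zs. u \<notin> insert y S"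
    using split_list_last_prop[of p "\<lambda>v. v \<in> insert y S"] by blast
  have "walk (insert (x, y) E) (v # zs)" using p ys(1) walk_suffix by metis
  then have "walk E (v # zs)" using ys(3) walk_delete_edge_head[of x y E "v # zs"] by auto
  moreover have "last (v # zs) \<in> B" using p ys(1) by (metis last_appendR list.distinct(1))
  moreover have "hd (v # zs) \<in> insert y S" using ys(2) by simp
  ultimately have "set (v # zs) \<inter> T \<noteq> {}" using T unfolding separates_def by blast
  then show "set p \<inter> T \<noteq> {}" using ys(1) by auto
qed

section \<open>Linkages that use every source or every target\<close>

lemma linkage_last_bij:
  assumes P: "linkage E A B P" and "finite B" "card P = card B"
  shows "bij_betw last P B"
proof -
  have "inj_on last P"
    by (rule inj_onI) (metis linkage_eqI[OF P] linkageD(5)[OF P] last_in_set)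
  moreover have "last ` P \<subseteq> B" using linkageD(4)[OF P] by blast
  ultimately show ?thesis
    using assms(2,3) by (metis bij_betw_def card_image card_subset_eq)
qed

lemma linkage_hd_bij:
  assumes P: "linkage E A B P" and "finite A" "card P = card A"
  shows "bij_betw hd P A"
proof -
  have "inj_on hd P"
    by (rule inj_onI) (metis linkage_eqI[OF P] linkageD(5)[OF P] hd_in_set)
  moreover have "hd ` P \<subseteq> A" using linkageD(3)[OF P] by blast
  ultimately show ?thesis
    using assms(2,3) by (metis bij_betw_def card_image card_subset_eq)
qed

text \<open>Every node of \<open>B\<close> already ends some path of \<open>P\<close>, so by
  disjointness no other path contains it.\<close>

lemma linkage_meets_target_at_last:
  assumes P: "linkage E A B P" and bij: "bij_betw last P B" and "p \<in> P" "v \<in> set p" "v \<in> B"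
  shows "v = last p"
proof -
  obtain q where "q \<in> P" "last q = v" using bij \<open>v \<in> B\<close> by (metis bij_betw_def imageE)
  then show ?thesis
    using linkage_eqI[OF P, of q p v] linkageD(5)[OF P, of q] assms(3,4) last_in_set by blast
qed

lemma linkage_meets_source_at_hd:
  assumes P: "linkage E A B P" and bij: "bij_betw hd P A" and "p \<in> P" "v \<in> set p" "v \<in> A"
  shows "v = hd p"
proof -
  obtain q where "q \<in> P" "hd q = v" using bij \<open>v \<in> A\<close> by (metis bij_betw_def imageE)
  then show ?thesis
    using linkage_eqI[OF P, of q p v] linkageD(5)[OF P, of q] assms(3,4) hd_in_set by blast
qed

text \<open>Switching from \<open>p\<close> to \<open>q\<close> at a common node gives a walk from
  \<open>A\<close> to \<open>B\<close> in \<open>E\<close>, which \<open>S\<close> must hit. But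
  \<open>p\<close> can meet \<open>S\<close> only at its end and \<open>q\<close> only at its start,
  so the node hit is \<open>v\<close> itself.\<close>

lemma linkages_meet_in_separator:
  assumes P: "linkage E A (insert x S) P" "bij_betw last P (insert x S)"
    and Q: "linkage E (insert y S) B Q" "bij_betw hd Q (insert y S)"
    and S: "separates E A B S"
    and p: "p \<in> P" "v \<in> set p" and q: "q \<in> Q" "v \<in> set q"
  shows "v \<in> S"
proof -
  obtain ps ps' where ps: "p = ps @ v # ps'" using p(2) by (meson split_list)
  obtain qs qs' where qs: "q = qs @ v # qs'" using q(2) by (meson split_list)
  let ?w = "(ps @ [v]) @ tl (v # qs')"
  have "walk E (ps @ [v])" using linkageD(1)[OF P(1) p(1)] ps walk_prefix by metis
  moreover have "walk E (v # qs')" using linkageD(1)[OF Q(1) q(1)] qs walk_suffix by metis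
  ultimately have "walk E ?w" by (intro walk_append_tl) auto
  moreover have "hd ?w \<in> A" using linkageD(3)[OF P(1) p(1)] ps by (cases ps) auto
  moreover have "last ?w \<in> B" using linkageD(4)[OF Q(1) q(1)] qs by auto
  ultimately obtain s where s: "s \<in> set ?w" "s \<in> S" using S separatesD by metis
  then consider "s \<in> set (ps @ [v])" | "s \<in> set (v # qs')" by auto
  then show ?thesis
  proof cases
    case 1
    then have "s = last p" using linkage_meets_target_at_last[OF P p(1)] s(2) ps by auto
    then show ?thesis using 1 s(2) linkageD(2)[OF P(1) p(1)] ps by (cases ps' rule: rev_cases) auto
  next
    case 2
    then have "s = hd q" using linkage_meets_source_at_hd[OF Q q(1)] s(2) qs by auto
    then show ?thesis using 2 s(2) linkageD(2)[OF Q(1) q(1)] qs by (cases qs) auto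
  qed
qed

text \<open>A path reaching a node of \<open>S\<close> continues with the path leaving that node;
  the path reaching \<open>x\<close> crosses the new edge to the path leaving \<open>y\<close>. The
  cardinalities ensure that every node of \<open>insert x S\<close> is reached and every node of
  \<open>insert y S\<close> is left.\<close>

lemma linkage_join:
  assumes P: "linkage E A (insert x S) P" "card P = Suc (card S)"
    and Q: "linkage E (insert y S) B Q" "card Q = Suc (card S)"
    and S: "separates E A B S" "finite S" "x \<notin> S" "y \<notin> S"
  shows "\<exists>R. linkage (insert (x, y) E) A B R \<and> card R = Suc (card S)"
proof -
  have bP: "bij_betw last P (insert x S)" using linkage_last_bij[OF P(1)] P(2) S by simp
  have bQ: "bij_betw hd Q (insert y S)" using linkage_hd_bij[OF Q(1)] Q(2) S by simp
  define f where "f = the_inv_into P last"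
  define g where "g = the_inv_into Q hd"
  have f: "f z \<in> P" "last (f z) = z" if "z \<in> insert x S" for z
    using that bP unfolding f_def
    by (metis bij_betw_def order_refl the_inv_into_into, metis bij_betw_def f_the_inv_into_f)
  have g: "g z \<in> Q" "hd (g z) = z" if "z \<in> insert y S" for z
    using that bQ unfolding g_def
    by (metis bij_betw_def order_refl the_inv_into_into, metis bij_betw_def f_the_inv_into_f)
  \<comment> \<open>\<open>\<sigma>\<close> matches ends of paths in \<open>P\<close> with starts of
    paths in \<open>Q\<close>. At a node of \<open>S\<close> both paths contain the junction, so
    \<open>h\<close> drops the second copy; from \<open>x\<close> to \<open>y\<close> the new edge
    is used and nothing is dropped.\<close>
  define \<sigma> where "\<sigma> z = (if z = x then y else z)" for z
  define h where "h z = (if z = x then g y else tl (g z))" for z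
  have \<sigma>: "\<sigma> z \<in> insert y S" if "z \<in> insert x S" for z using that by (auto simp: \<sigma>_def)
  have \<sigma>_inj: "z = z'" if "z \<in> insert x S" "z' \<in> insert x S" "\<sigma> z = \<sigma> z'" for z z'
    using that S(3,4) by (auto simp: \<sigma>_def split: if_splits)
  have h_sub: "set (h z) \<subseteq> set (g (\<sigma> z))" if "z \<in> insert x S" for z
    by (cases "g z") (auto simp: h_def \<sigma>_def)
  \<comment> \<open>A node of \<open>S\<close> on \<open>h z\<close> heads its path in
    \<open>Q\<close>, and \<open>tl\<close> removes that head unless \<open>z = x\<close>. The
    conclusion then gives \<open>v = y\<close>, against \<open>y \<notin> S\<close>, so in fact no
    \<open>h z\<close> meets \<open>S\<close>.\<close>
  have h_S: "v = \<sigma> z \<and> z = x" if z: "z \<in> insert x S" and v: "v \<in> set (h z)" "v \<in> S" for z v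
  proof -
    have gz: "g (\<sigma> z) \<in> Q" using g(1)[OF \<sigma>[OF z]] .
    have "v = hd (g (\<sigma> z))"
      using linkage_meets_source_at_hd[OF Q(1) bQ gz] h_sub[OF z] v by blast
    then have vz: "v = \<sigma> z" using g(2)[OF \<sigma>[OF z]] by simp
    have "hd (g z) \<notin> set (tl (g z))" if "z \<noteq> x"
      using gz linkageD(2,5)[OF Q(1) gz] that by (cases "g z") (auto simp: \<sigma>_def)
    then show ?thesis using v vz g(2)[OF \<sigma>[OF z]] by (auto simp: h_def \<sigma>_def split: if_splits)
  qed
  \<comment> \<open>The case \<open>z = z'\<close> is included: it makes \<open>r z\<close>
    distinct.\<close>
  have fg: "set (f z) \<inter> set (h z') = {}" if z: "z \<in> insert x S" "z' \<in> insert x S" for z z'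
  proof (rule ccontr)
    assume "\<not> ?thesis"
    then obtain v where v: "v \<in> set (f z)" "v \<in> set (h z')" by blast
    then have "v \<in> S"
      using linkages_meet_in_separator[OF P(1) bP Q(1) bQ S(1)] f(1)[OF z(1)] g(1)[OF \<sigma>[OF z(2)]]
        h_sub[OF z(2)] by blast
    then show False using h_S[OF z(2) v(2)] S(4) by (auto simp: \<sigma>_def)
  qed
  define r where "r z = f z @ h z" for z
  have r_disj: "set (r z) \<inter> set (r z') = {}" if z: "z \<in> insert x S" "z' \<in> insert x S" "z \<noteq> z'" for z z'
  proof -
    have "set (f z) \<inter> set (f z') = {}"
      using linkage_eqI[OF P(1) f(1)[OF z(1)] f(1)[OF z(2)]] f(2) z by (metis disjoint_iff)
    moreover have "set (h z) \<inter> set (h z') = {}"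
    proof -
      have "g (\<sigma> z) \<noteq> g (\<sigma> z')" using g(2)[OF \<sigma>] \<sigma>_inj z by metis
      then have "set (g (\<sigma> z)) \<inter> set (g (\<sigma> z')) = {}"
        using linkage_eqI[OF Q(1) g(1)[OF \<sigma>[OF z(1)]] g(1)[OF \<sigma>[OF z(2)]]] by blast
      then show ?thesis using h_sub z by blast
    qed
    ultimately show ?thesis using fg[OF z(1,2)] fg[OF z(2,1)] unfolding r_def set_append by blast
  qed
  have r_ne: "r z \<noteq> []" if "z \<in> insert x S" for z
    using linkageD(5)[OF P(1) f(1)[OF that]] by (simp add: r_def)
  have r_path: "walk (insert (x, y) E) (r z) \<and> distinct (r z) \<and> hd (r z) \<in> A \<and> last (r z) \<in> B"
    if z: "z \<in> insert x S" for z
  proof -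
    let ?q = "g (\<sigma> z)"
    note p = linkageD[OF P(1) f(1)[OF z]] and q = linkageD[OF Q(1) g(1)[OF \<sigma>[OF z]]]
    have wp: "walk (insert (x, y) E) (f z)" and wq: "walk (insert (x, y) E) ?q"
      using p(1) q(1) by (auto elim: walk_mono)
    have "walk (insert (x, y) E) (r z) \<and> last (r z) = last ?q"
    proof (cases "z = x")
      case True
      then have "r z = f z @ ?q" by (simp add: r_def h_def \<sigma>_def)
      then show ?thesis
        using walk_append[OF wp wq] f(2)[OF z] g(2)[OF \<sigma>[OF z]] True q(5) by (simp add: \<sigma>_def)
    next
      case False
      then have "r z = f z @ tl ?q" by (simp add: r_def h_def \<sigma>_def)
      moreover have "last (f z) = hd ?q"
        using f(2)[OF z] g(2)[OF \<sigma>[OF z]] False by (simp add: \<sigma>_def)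
      ultimately show ?thesis
        using walk_append_tl[OF wp wq] last_append_tl[OF q(5)] by simp
    qed
    moreover have "distinct (h z)" using q(2) by (auto simp: h_def \<sigma>_def distinct_tl)
    ultimately show ?thesis
      using p q fg[OF z z] by (simp add: r_def)
  qed
  have "inj_on r (insert x S)"
    by (rule inj_onI) (metis r_disj r_ne inf.idem set_empty)
  then have "card (r ` insert x S) = Suc (card S)" using S by (simp add: card_image)
  moreover have "linkage (insert (x, y) E) A B (r ` insert x S)"
    unfolding linkage_def using r_path r_disj by blast
  ultimately show ?thesis by blast
qed

lemma linkage_mono: "linkage E A B P \<Longrightarrow> E \<subseteq> E' \<Longrightarrow> linkage E' A B P"
  unfolding linkage_def using walk_mono by blast

text \<open>
  Goering's proof: when deleting the edge \<open>(x, y)\<close> leaves a separator \<open>S\<close> with fewer than \<open>k\<close>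
  nodes, the paths are glued from linkages from \<open>A\<close> to \<open>S \<union> {x}\<close> and from \<open>S \<union> {y}\<close> to \<open>B\<close>, both
  avoiding the edge.
\<close>

theorem menger:
  assumes "finite E" "finite A"
    and "\<And>S. finite S \<Longrightarrow> separates E A B S \<Longrightarrow> k \<le> card S"
  shows "\<exists>P. linkage E A B P \<and> card P = k"
  using assms
proof (induction E arbitrary: A B rule: finite_induct)
  case empty
  \<comment> \<open>Without edges every walk is a single node.\<close>
  have "separates {} A B (A \<inter> B)"
    unfolding separates_def
  proof (intro allI impI)
    fix p assume "walk {} p \<and> hd p \<in> A \<and> last p \<in> B"
    then show "set p \<inter> (A \<inter> B) \<noteq> {}"
      by (cases p; cases "tl p") (auto simp: walk_def)
  qed
  then have "k \<le> card (A \<inter> B)" using empty by simp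
  then obtain T where T: "T \<subseteq> A \<inter> B" "card T = k" by (meson obtain_subset_with_card_n)
  have "linkage {} A B ((\<lambda>a. [a]) ` T)"
    using T unfolding linkage_def walk_def by auto
  moreover have "card ((\<lambda>a. [a]) ` T) = k" using T(2) by (simp add: card_image inj_on_def)
  ultimately show ?case by blast
next
  case (insert e E)
  obtain x y where e: "e = (x, y)" by force
  show ?case
  proof (cases "\<exists>S. finite S \<and> separates E A B S \<and> card S < k")
    case False
    then have "\<exists>P. linkage E A B P \<and> card P = k"
      using insert.IH[OF insert.prems(1)] by (meson leI)
    then show ?thesis using linkage_mono by (metis subset_insertI)
  next
    case True
    then obtain S where S: "finite S" "separates E A B S" "card S < k" by blast
    note sx = separates_insert_tail[OF S(2), of x y] and sy = separates_insert_head[OF S(2), of x y]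
    \<comment> \<open>Both enlarged sets separate in the full graph and so have at least
      \<open>k\<close> nodes, while \<open>S\<close> has fewer. This leaves only
      \<open>k - 1\<close> for \<open>card S\<close> and keeps \<open>x\<close> and \<open>y\<close>
      out of \<open>S\<close>.\<close>
    have kx: "k \<le> card (insert x S)" and ky: "k \<le> card (insert y S)"
      using insert.prems(2) sx sy S(1) e by simp_all
    then have xy: "x \<notin> S" "y \<notin> S" and k: "k = Suc (card S)"
      using S by (auto simp: card_insert_if split: if_splits)
    \<comment> \<open>A finite set separating \<open>A\<close> from \<open>insert x S\<close> in
      \<open>E\<close> also separates \<open>A\<close> from \<open>B\<close> in the full graph, so
      it has at least \<open>k\<close> nodes and the induction hypothesis applies.\<close>
    obtain P where "linkage E A (insert x S) P" "card P = k"
      using insert.IH[OF insert.prems(1), of "insert x S"] insert.prems(2)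
        separates_from_source_side[OF sx] e by metis
    moreover obtain Q where "linkage E (insert y S) B Q" "card Q = k"
      using insert.IH[of "insert y S" B] insert.prems(2)
        separates_from_target_side[OF sy] e S(1) finite_insert by metis
    ultimately show ?thesis using linkage_join[of E A x S P y B Q] S(1,2) xy k e by simp
  qed
qed

text \<open>Charge every walk to a node of \<open>S\<close> on it; no node is charged more than
  \<open>c\<close> times. Indexing by \<open>I\<close> lets equal walks be counted
  separately.\<close>

lemma separator_card_ge:
  assumes "finite I" "finite S" "separates E A B S"
    and walks: "\<And>i. i \<in> I \<Longrightarrow> walk E (\<pi> i) \<and> hd (\<pi> i) \<in> A \<and> last (\<pi> i) \<in> B"
    and load: "\<And>v. card {i\<in>I. v \<in> set (\<pi> i)} \<le> c"
  shows "card I \<le> card S * c"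
proof -
  have "I \<subseteq> (\<Union>v\<in>S. {i\<in>I. v \<in> set (\<pi> i)})"
    using walks assms(3) unfolding separates_def by blast
  then have "card I \<le> card (\<Union>v\<in>S. {i\<in>I. v \<in> set (\<pi> i)})"
    using assms(1,2) by (intro card_mono) auto
  also have "\<dots> \<le> (\<Sum>v\<in>S. card {i\<in>I. v \<in> set (\<pi> i)})"
    using assms(2) by (rule card_UN_le)
  also have "\<dots> \<le> card S * c"
    using load sum_bounded_above[of S "\<lambda>v. card {i\<in>I. v \<in> set (\<pi> i)}" c] by simp
  finally show ?thesis .
qed

section \<open>Routing in a butterfly\<close>

text \<open>
  The path from input \<open>x\<close> to output \<open>y\<close> passes layer \<open>i\<close> in the node labelled \<open>mix i x y\<close>, because
  the edges into layers \<open>1, \<dots>, i\<close> have set exactly the coordinates \<open>1, \<dots>, i\<close>.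
\<close>

definition mix :: "nat \<Rightarrow> (nat \<Rightarrow> nat) \<Rightarrow> (nat \<Rightarrow> nat) \<Rightarrow> nat \<Rightarrow> nat" where
  "mix i x y = (\<lambda>j. if j \<le> i then y j else x j)"

lemma mix_in_labels: "x \<in> labels d \<Longrightarrow> y \<in> labels d \<Longrightarrow> mix i x y \<in> labels d"
  unfolding labels_def mix_def PiE_def extensional_def Pi_def by auto

lemma mix_0: "x \<in> labels d \<Longrightarrow> y \<in> labels d \<Longrightarrow> mix 0 x y = x"
  unfolding labels_def mix_def PiE_def extensional_def by (auto simp: fun_eq_iff)

lemma mix_dim: "x \<in> labels d \<Longrightarrow> y \<in> labels d \<Longrightarrow> mix d x y = y"
  unfolding labels_def mix_def PiE_def extensional_def by (auto simp: fun_eq_iff)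

text \<open>The two mixtures are complementary: at each coordinate one shows the entry of
  \<open>x\<close> and the other that of \<open>y\<close>, and \<open>i\<close> alone decides
  which.\<close>

lemma mix_swap_eqD:
  assumes "mix i x y = mix i x' y'" "mix i y x = mix i y' x'"
  shows "x = x' \<and> y = y'"
proof -
  have "x j = x' j \<and> y j = y' j" for j
    using fun_cong[OF assms(1), of j] fun_cong[OF assms(2), of j]
    by (auto simp: mix_def split: if_splits)
  then show ?thesis by (auto simp: fun_eq_iff)
qed

lemma finite_labels: "finite (labels d)"
  unfolding labels_def by (intro finite_PiE) auto

lemma card_labels: "card (labels d) = 2 ^ d"
  unfolding labels_def by (simp add: card_PiE numeral_2_eq_2)

text \<open>The discarded half \<open>mix i y (\<delta> x)\<close> determines \<open>(x, y)\<close> within a fibre.\<close>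

lemma card_mix_fibre:
  assumes \<delta>: "inj_on \<delta> (labels d)" "\<delta> ` labels d \<subseteq> labels d"
  shows "card {(x, y) \<in> labels d \<times> labels d. mix i (\<delta> x) y = l} \<le> 2 ^ d"
proof -
  let ?F = "{(x, y) \<in> labels d \<times> labels d. mix i (\<delta> x) y = l}"
  let ?s = "\<lambda>(x, y). mix i y (\<delta> x)"
  have "inj_on ?s ?F"
  proof (rule inj_onI)
    fix u v assume u: "u \<in> ?F" and v: "v \<in> ?F" and s: "?s u = ?s v"
    obtain x y x' y' where uv: "u = (x, y)" "v = (x', y')" by fastforce
    have "\<delta> x = \<delta> x' \<and> y = y'"
      using u v s uv by (intro mix_swap_eqD[of i]) auto
    then show "u = v" using u v uv \<delta>(1) by (auto dest: inj_onD)
  qed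
  moreover have "?s ` ?F \<subseteq> labels d" using \<delta>(2) mix_in_labels by fastforce
  ultimately show ?thesis
    using card_inj_on_le[OF _ _ finite_labels, of ?s ?F d] by (simp only: card_labels)
qed

section \<open>Routes from inputs to outputs\<close>

lemma verts_butterfly: "verts (butterfly d) = {0..d} \<times> labels d"
  unfolding butterfly_def layer_def by auto

lemma mix_arc:
  assumes "i < d" "x \<in> labels d" "y \<in> labels d"
  shows "((i, mix i x y), (Suc i, mix (Suc i) x y)) \<in> arcs (butterfly d)"
proof -
  have "\<forall>j\<in>{1..d} - {Suc i}. mix (Suc i) x y j = mix i x y j" by (auto simp: mix_def)
  then show ?thesis
    using assms mix_in_labels[OF assms(2,3)] unfolding butterfly_def by fastforce
qed

text \<open>\<open>f\<close> places the standard butterfly in another graph, so one definition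
  serves both halves of a pair.\<close>

definition route :: "(bnode \<Rightarrow> 'v) \<Rightarrow> nat \<Rightarrow> (nat \<Rightarrow> nat) \<Rightarrow> (nat \<Rightarrow> nat) \<Rightarrow> 'v list" where
  "route f d x y = map (\<lambda>i. f (i, mix i x y)) [0..<Suc d]"

lemma walk_route:
  assumes "\<And>u v. (u, v) \<in> arcs (butterfly d) \<Longrightarrow> (f u, f v) \<in> E" "x \<in> labels d" "y \<in> labels d"
  shows "walk E (route f d x y)"
  using mix_arc[OF _ assms(2,3)] assms(1)
  unfolding walk_def route_def successively_map by (auto simp: successively_conv_nth simp del: upt_Suc)

lemma hd_route: "x \<in> labels d \<Longrightarrow> y \<in> labels d \<Longrightarrow> hd (route f d x y) = f (0, x)"
  unfolding route_def by (simp add: hd_map mix_0 del: upt_Suc)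

lemma last_route: "x \<in> labels d \<Longrightarrow> y \<in> labels d \<Longrightarrow> last (route f d x y) = f (d, y)"
  unfolding route_def by (simp add: mix_dim)

lemma in_set_route:
  "v \<in> set (route f d x y) \<longleftrightarrow> (\<exists>i\<le>d. v = f (i, mix i x y))"
  unfolding route_def by (auto simp: less_Suc_eq_le simp del: upt_Suc)

lemma in_set_tl_route:
  "v \<in> set (tl (route f d x y)) \<longleftrightarrow> (\<exists>i. 1 \<le> i \<and> i \<le> d \<and> v = f (i, mix i x y))"
  unfolding route_def by (auto simp: map_tl[symmetric] less_Suc_eq_le simp del: upt_Suc)

section \<open>Pairs of butterflies\<close>

text \<open>The counting argument, freed from the encoding of the glued graph: \<open>f\<close> and
  \<open>g\<close> place the two butterflies, and \<open>\<delta>\<close> turns the label of a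
  middle node as an output of the first into its label as an input of the second.\<close>

lemma two_butterflies_linkage:
  fixes f g :: "bnode \<Rightarrow> 'v"
  assumes E: "finite E"
      "\<And>u v. (u, v) \<in> arcs (butterfly d) \<Longrightarrow> (f u, f v) \<in> E"
      "\<And>u v. (u, v) \<in> arcs (butterfly d) \<Longrightarrow> (g u, g v) \<in> E"
    and inj: "inj_on f (verts (butterfly d))" "inj_on g (verts (butterfly d))"
    and disj: "f ` verts (butterfly d) \<inter> g ` (verts (butterfly d) - layer d 0) = {}"
    and \<delta>: "inj_on \<delta> (labels d)" "\<delta> ` labels d \<subseteq> labels d"
    and fg: "\<And>c. c \<in> labels d \<Longrightarrow> f (d, c) = g (0, \<delta> c)"
    and A: "A \<subseteq> f ` layer d 0" and B: "B \<subseteq> g ` layer d d" and AB: "card A = card B"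
  shows "\<exists>P. linkage E A B P \<and> card P = card A"
proof (rule menger[OF E(1)])
  show "finite A" using A finite_labels by (auto intro: finite_subset simp: layer_def)
  fix S assume S: "finite S" "separates E A B S"
  define L where "L = labels d"
  define A' where "A' = {x\<in>L. f (0, x) \<in> A}"
  define B' where "B' = {y\<in>L. g (d, y) \<in> B}"
  have fin: "finite L" "finite A'" "finite B'" by (auto simp: L_def A'_def B'_def finite_labels)
  have "A = (\<lambda>x. f (0, x)) ` A'" using A by (auto simp: A'_def L_def layer_def)
  moreover have "inj_on (\<lambda>x. f (0, x)) A'"
    by (rule inj_onI) (auto simp: A'_def L_def verts_butterfly dest: inj_onD[OF inj(1)])
  ultimately have cA: "card A' = card A" by (simp add: card_image)
  have "B = (\<lambda>x. g (d, x)) ` B'" using B by (auto simp: B'_def L_def layer_def)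
  moreover have "inj_on (\<lambda>x. g (d, x)) B'"
    by (rule inj_onI) (auto simp: B'_def L_def verts_butterfly dest: inj_onD[OF inj(2)])
  ultimately have cB: "card B' = card A" using AB by (simp add: card_image)
  define I where "I = A' \<times> L \<times> B'"
  \<comment> \<open>\<open>tl\<close> removes the second copy of the middle node, which by
    \<open>fg\<close> ends the first route.\<close>
  define \<pi> where "\<pi> = (\<lambda>(x, c, y). route f d x c @ tl (route g d (\<delta> c) y))"
  have "card I \<le> card S * (2 ^ d * card A)"
  proof (rule separator_card_ge[OF _ S])
    show "finite I" using fin by (simp add: I_def)
    show "walk E (\<pi> i) \<and> hd (\<pi> i) \<in> A \<and> last (\<pi> i) \<in> B" if "i \<in> I" for i
    proof -
      obtain x c y where i: "i = (x, c, y)" by (cases i)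
      have xy: "x \<in> labels d" "c \<in> labels d" "y \<in> labels d" "f (0, x) \<in> A" "g (d, y) \<in> B"
        using that by (auto simp: I_def A'_def B'_def L_def i)
      have \<delta>c: "\<delta> c \<in> labels d" using \<delta>(2) xy(2) by blast
      let ?p = "route f d x c" and ?q = "route g d (\<delta> c) y"
      have w: "walk E ?p" "walk E ?q" 
        using walk_route[OF E(2) xy(1,2)] walk_route[OF E(3) \<delta>c xy(3)] by simp_all
      then have ne: "?p \<noteq> []" "?q \<noteq> []" by (auto simp: walk_def)
      have "last ?p = hd ?q" using xy \<delta>c by (simp add: hd_route last_route fg)
      then show ?thesis
        using walk_append_tl[OF w] last_append_tl[OF ne(2)] xy \<delta>c ne(1)
        by (simp add: \<pi>_def i hd_route last_route)
    qed
    \<comment> \<open>Middle nodes lie in both images. The case split treats them as nodes of the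
      first butterfly, where \<open>disj\<close> keeps them off the truncated second route.\<close>
    show "card {i\<in>I. v \<in> set (\<pi> i)} \<le> 2 ^ d * card A" for v
    proof (cases "v \<in> f ` verts (butterfly d)")
      case True
      then obtain j l where v: "v = f (j, l)" "(j, l) \<in> verts (butterfly d)" by auto
      \<comment> \<open>\<open>(x, c)\<close> is confined to a fibre of at most \<open>2 ^ d\<close>
        pairs, while \<open>y\<close> is free in \<open>B'\<close>.\<close>
      let ?F = "{(x, c) \<in> labels d \<times> labels d. mix j x c = l}"
      have "{i\<in>I. v \<in> set (\<pi> i)} \<subseteq> (\<lambda>((x, c), y). (x, c, y)) ` (?F \<times> B')"
      proof
        fix i assume "i \<in> {i\<in>I. v \<in> set (\<pi> i)}"
        then obtain x c y where i: "i = (x, c, y)" "x \<in> labels d" "c \<in> labels d" "y \<in> B'" "y \<in> labels d"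
            "v \<in> set (route f d x c) \<or> v \<in> set (tl (route g d (\<delta> c) y))"
          by (cases i) (auto simp: I_def A'_def B'_def L_def \<pi>_def)
        have "v \<notin> set (tl (route g d (\<delta> c) y))"
        proof
          assume "v \<in> set (tl (route g d (\<delta> c) y))"
          then obtain k where "1 \<le> k" "k \<le> d" "v = g (k, mix k (\<delta> c) y)"
            by (auto simp: in_set_tl_route)
          moreover from this have "(k, mix k (\<delta> c) y) \<in> verts (butterfly d) - layer d 0"
            using i \<delta>(2) mix_in_labels by (auto simp: verts_butterfly layer_def)
          ultimately show False using disj True by blast
        qed
        then obtain k where k: "k \<le> d" "v = f (k, mix k x c)" using i(6) by (auto simp: in_set_route)
        moreover have "(k, mix k x c) \<in> verts (butterfly d)"
          using k(1) i mix_in_labels by (auto simp: verts_butterfly)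
        ultimately have "(k, mix k x c) = (j, l)" using inj_onD[OF inj(1)] v by metis
        then have "((x, c), y) \<in> ?F \<times> B'" using i by auto
        then show "i \<in> (\<lambda>((x, c), y). (x, c, y)) ` (?F \<times> B')" 
          by (rule rev_image_eqI) (simp add: i(1))
      qed
      moreover have "finite ?F"
        using finite_labels by (auto intro: finite_subset[of _ "labels d \<times> labels d"])
      ultimately have "card {i\<in>I. v \<in> set (\<pi> i)} \<le> card (?F \<times> B')"
        using fin(3) by (intro surj_card_le) auto
      also have "\<dots> \<le> 2 ^ d * card A"
        using card_mix_fibre[of "\<lambda>x. x" d j l] by (simp add: card_cartesian_product cB)
      finally show ?thesis .
    next
      case False
      show ?thesis
      proof (cases "v \<in> g ` verts (butterfly d)")
        case True
        then obtain j l where v: "v = g (j, l)" "(j, l) \<in> verts (butterfly d)" by auto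
        \<comment> \<open>Now \<open>(c, y)\<close> is confined to a fibre and \<open>x\<close> is
          free in \<open>A'\<close>.\<close>
        let ?F = "{(c, y) \<in> labels d \<times> labels d. mix j (\<delta> c) y = l}"
        have "{i\<in>I. v \<in> set (\<pi> i)} \<subseteq> A' \<times> ?F"
        proof
          fix i assume "i \<in> {i\<in>I. v \<in> set (\<pi> i)}"
          then obtain x c y where i: "i = (x, c, y)" "x \<in> A'" "x \<in> labels d" "c \<in> labels d" "y \<in> labels d"
              "v \<in> set (route f d x c) \<or> v \<in> set (tl (route g d (\<delta> c) y))"
            by (cases i) (auto simp: I_def A'_def B'_def L_def \<pi>_def)
          have "v \<notin> set (route f d x c)"
            using False i mix_in_labels by (auto simp: in_set_route verts_butterfly)
          then obtain k where k: "k \<le> d" "v = g (k, mix k (\<delta> c) y)"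
            using i(6) by (auto simp: in_set_tl_route)
          moreover have "(k, mix k (\<delta> c) y) \<in> verts (butterfly d)"
            using k(1) i \<delta>(2) mix_in_labels by (auto simp: verts_butterfly)
          ultimately have "(k, mix k (\<delta> c) y) = (j, l)" using inj_onD[OF inj(2)] v by metis
          then show "i \<in> A' \<times> ?F" using i by auto
        qed
        moreover have "finite ?F"
          using finite_labels by (auto intro: finite_subset[of _ "labels d \<times> labels d"])
        ultimately have "card {i\<in>I. v \<in> set (\<pi> i)} \<le> card (A' \<times> ?F)"
          using fin(2) by (intro card_mono) auto
        also have "\<dots> \<le> 2 ^ d * card A"
          using card_mix_fibre[OF \<delta>, of j l] by (simp add: card_cartesian_product cA)
        finally show ?thesis .
      next
        case False': False
        have "v \<notin> set (\<pi> i)" if "i \<in> I" for i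
        proof -
          obtain x c y where i: "i = (x, c, y)" by (cases i)
          have "x \<in> labels d" "c \<in> labels d" "y \<in> labels d"
            using that by (auto simp: I_def A'_def B'_def L_def i)
          then show ?thesis
            using False False' \<delta>(2) mix_in_labels
            by (auto simp: \<pi>_def i in_set_route in_set_tl_route verts_butterfly)
        qed
        then have "{i\<in>I. v \<in> set (\<pi> i)} = {}" by blast
        then show ?thesis by (simp only: card.empty)
      qed
    qed
  qed
  then have "card A * (2 ^ d * card A) \<le> card S * (2 ^ d * card A)"
    by (simp add: I_def L_def card_cartesian_product card_labels cA cB)
  \<comment> \<open>Cancelling \<open>2 ^ d * card A\<close> requires \<open>card A\<close> to be
    positive; otherwise the bound is trivial.\<close>
  then show "card A \<le> card S" by (cases "card A = 0") auto
qed

section \<open>From linkages to paths in the glued digraph\<close>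

lemma inj_glue_node:
  assumes "inj_on \<phi> S"
  shows "inj (glue_node \<phi> S)"
proof (rule injI)
  fix v w assume "glue_node \<phi> S v = glue_node \<phi> S w"
  then show "v = w"
    by (auto simp: glue_node_def the_inv_into_f_f[OF assms] split: if_splits)
qed

lemma wf_digraph_glue:
  assumes "wf_digraph G1" "wf_digraph G2"
  shows "wf_digraph (glue \<phi> S G1 G2)"
proof -
  interpret G1: wf_digraph G1 by fact
  interpret G2: wf_digraph G2 by fact
  show ?thesis by unfold_locales (auto simp: glue_def)
qed

text \<open>Well-formedness puts the ends of edges into \<open>verts G\<close>, but a one-node walk
  has no edge; the hypothesis on the head covers it.\<close>

lemma vwalk_if_walk:
  assumes "wf_digraph G" "walk (arcs_ends G) p" "hd p \<in> verts G"
  shows "vwalk p G"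
proof -
  interpret wf_digraph G by fact
  from assms(2,3) show ?thesis
  proof (induction p rule: vwalk_arcs.induct)
    case (3 x y xs)
    then have xy: "(x, y) \<in> arcs_ends G" by (simp add: walk_def)
    then have "x \<in> verts G" "y \<in> verts G" using adj_in_verts by blast+
    then have "vwalk (y # xs) G" using 3 by (simp add: walk_def)
    then show ?case using xy \<open>x \<in> verts G\<close> by (simp add: vwalk_def)
  qed (auto simp: walk_def vwalk_def)
qed

lemma node_disjoint_paths_if_linkage:
  assumes "wf_digraph G" "A \<subseteq> verts G" "linkage (arcs_ends G) A B P" "card P = card A" "finite P"
  shows "node_disjoint_paths G A B"
  unfolding node_disjoint_paths_def
proof (intro exI[of _ P] conjI ballI)
  fix p assume p: "p \<in> P"
  note pp = linkageD[OF assms(3) p]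
  show "vpath p G" using vwalk_if_walk[OF assms(1) pp(1)] pp(2,3) assms(2) by (auto simp: vpath_def)
  show "hd p \<in> A" "last p \<in> B" using pp by auto
qed (use assms in \<open>auto simp: linkage_def\<close>)

lemma finite_arcs_butterfly: "finite (arcs (butterfly d))"
proof (rule finite_subset)
  show "arcs (butterfly d) \<subseteq> verts (butterfly d) \<times> verts (butterfly d)"
    unfolding verts_butterfly by (auto simp: butterfly_def)
  show "finite (verts (butterfly d) \<times> verts (butterfly d))"
    by (simp add: verts_butterfly finite_labels)
qed

theorem butterfly_pair_concentrator:
  fixes G :: "('a + 'b, 'e + 'f) pre_digraph"
  assumes "butterfly_pair d G ins outs" "0 < k"
  shows "concentrator k G ins outs"
proof -
  let ?H = "butterfly d"
  obtain G1 :: "('a, 'e) pre_digraph" and ins1 outs1 and G2 :: "('b, 'f) pre_digraph" and ins2 outs2 \<phi>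
    where G1: "butterfly_copy d G1 ins1 outs1" and G2: "butterfly_copy d G2 ins2 outs2"
      and \<phi>: "bij_betw \<phi> outs1 ins2" and G: "G = glue \<phi> outs1 G1 G2"
      and ins: "ins = Inl ` ins1" and outs: "outs = glue_node \<phi> outs1 ` outs2"
    using assms(1) unfolding butterfly_pair_def by blast
  obtain f where f: "pre_digraph.digraph_isomorphism ?H f" "G1 = app_iso f ?H"
      "ins1 = iso_verts f ` layer d 0" "outs1 = iso_verts f ` layer d d"
    using G1 unfolding butterfly_copy_def by blast
  obtain g where g: "pre_digraph.digraph_isomorphism ?H g" "G2 = app_iso g ?H"
      "ins2 = iso_verts g ` layer d 0" "outs2 = iso_verts g ` layer d d"
    using G2 unfolding butterfly_copy_def by blast
  interpret H: wf_digraph ?H by (rule wf_digraph_butterfly)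
  have wf: "wf_digraph G"
    using G f(1,2) g(1,2) by (auto intro: wf_digraph_glue H.wf_digraphI_app_iso)
  note injf = H.digraph_isomorphism_inj_on_verts[OF f(1)]
    and injg = H.digraph_isomorphism_inj_on_verts[OF g(1)]
  have inj\<phi>: "inj_on \<phi> outs1" using \<phi> by (simp add: bij_betw_def)
  note inj_glue = inj_glue_node[OF inj\<phi>]
  \<comment> \<open>\<open>glue_node\<close> sends an input of the second copy to the output of the
    first copy identified with it, so both embeddings land in the nodes of \<open>G\<close>.\<close>
  let ?f = "\<lambda>u. Inl (iso_verts f u) :: 'a + 'b"
  let ?g = "\<lambda>u. glue_node \<phi> outs1 (iso_verts g u)"
  have layers: "layer d 0 \<subseteq> verts ?H" "layer d d \<subseteq> verts ?H"
    by (auto simp: verts_butterfly layer_def)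
  have ends: "tail ?H (u, v) = u" "head ?H (u, v) = v" for u v by (auto simp: butterfly_def)
  have E1: "(?f u, ?f v) \<in> arcs_ends G" if "(u, v) \<in> arcs ?H" for u v
    using that H.iso_verts_tail[OF f(1) that] H.iso_verts_head[OF f(1) that]
    unfolding arcs_ends_conv G f(2) glue_def ends
    by (auto intro!: rev_image_eqI[of "Inl (iso_arcs f (u, v))"])
  have E2: "(?g u, ?g v) \<in> arcs_ends G" if "(u, v) \<in> arcs ?H" for u v
    using that H.iso_verts_tail[OF g(1) that] H.iso_verts_head[OF g(1) that]
    unfolding arcs_ends_conv G g(2) glue_def ends
    by (auto intro!: rev_image_eqI[of "Inr (iso_arcs g (u, v))"])
  have finE: "finite (arcs_ends G)"
    unfolding arcs_ends_conv G f(2) g(2) glue_def by (simp add: finite_arcs_butterfly)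
  \<comment> \<open>Reading \<open>\<phi>\<close> in standard labels on both sides yields
    \<open>\<delta>\<close>.\<close>
  have "\<forall>c\<in>labels d. \<exists>c'\<in>labels d. \<phi> (iso_verts f (d, c)) = iso_verts g (0, c')"
  proof
    fix c assume "c \<in> labels d"
    then have "\<phi> (iso_verts f (d, c)) \<in> iso_verts g ` layer d 0"
      using \<phi> f(4) g(3) by (auto simp: bij_betw_def layer_def)
    then show "\<exists>c'\<in>labels d. \<phi> (iso_verts f (d, c)) = iso_verts g (0, c')"
      by (auto simp: layer_def)
  qed
  then obtain \<delta> where \<delta>: "\<forall>c\<in>labels d. \<delta> c \<in> labels d \<and> \<phi> (iso_verts f (d, c)) = iso_verts g (0, \<delta> c)"
    using bchoice[of "labels d" "\<lambda>c c'. c' \<in> labels d \<and> \<phi> (iso_verts f (d, c)) = iso_verts g (0, c')"]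
    by blast
  have out1: "iso_verts f (d, c) \<in> outs1" if "c \<in> labels d" for c
    using that f(4) by (auto simp: layer_def)
  have \<delta>inj: "inj_on \<delta> (labels d)"
  proof (rule inj_onI)
    fix c c' assume c: "c \<in> labels d" "c' \<in> labels d" "\<delta> c = \<delta> c'"
    then have "iso_verts f (d, c) = iso_verts f (d, c')"
      using \<delta> out1 inj_onD[OF inj\<phi>] by metis
    then show "c = c'" using inj_onD[OF injf] c by (auto simp: verts_butterfly)
  qed
  have glued: "?f (d, c) = ?g (0, \<delta> c)" if c: "c \<in> labels d" for c
  proof -
    have "iso_verts g (0, \<delta> c) = \<phi> (iso_verts f (d, c))" using \<delta> c by simp
    then show ?thesis
      using out1[OF c] the_inv_into_f_f[OF inj\<phi>] by (simp add: glue_node_def)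
  qed
  have disj: "?f ` verts ?H \<inter> ?g ` (verts ?H - layer d 0) = {}"
  proof -
    have "?g u = Inr (iso_verts g u)" if u: "u \<in> verts ?H - layer d 0" for u
    proof -
      have "iso_verts g u \<notin> iso_verts g ` layer d 0"
        using u layers(1) inj_onD[OF injg] by blast
      then show ?thesis using \<phi> g(3) by (simp add: glue_node_def bij_betw_def)
    qed
    then show ?thesis by auto
  qed
  show ?thesis
    unfolding concentrator_def
  proof (intro allI impI, elim conjE)
    fix A B assume A: "A \<subseteq> ins" "card A = k" and B: "B \<subseteq> outs" "card B = k"
    have "\<exists>P. linkage (arcs_ends G) A B P \<and> card P = card A"
    proof (rule two_butterflies_linkage[OF finE, of d ?f ?g \<delta>])
      show "inj_on ?f (verts ?H)" using injf by (simp add: inj_on_def)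
      show "inj_on ?g (verts ?H)" using injg inj_glue by (simp add: inj_on_def)
      show "A \<subseteq> ?f ` layer d 0" using A(1) ins f(3) by auto
      show "B \<subseteq> ?g ` layer d d" using B(1) outs g(4) by auto
    qed (use E1 E2 disj \<delta> \<delta>inj glued A B in auto)
    then obtain P where P: "linkage (arcs_ends G) A B P" "card P = card A" by blast
    have "ins \<subseteq> verts G" using layers(1) unfolding ins f(3) G f(2) glue_def by auto
    then have "A \<subseteq> verts G" using A(1) by blast
    \<comment> \<open>An infinite set has \<open>card\<close> 0, so positivity of \<open>k\<close>
      gives finiteness.\<close>
    moreover have "finite P" using P(2) A(2) assms(2) by (auto intro: card_ge_0_finite)
    ultimately show "node_disjoint_paths G A B"
      using node_disjoint_paths_if_linkage[OF wf] P by blast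
  qed
qed

theorem theorem1:
  fixes G :: "('a + 'b, 'e + 'f) pre_digraph"
    and ins outs :: "('a + 'b) set"
    and d m :: nat
  assumes "butterfly_pair d G ins outs"
    and "m \<le> d"
  shows "concentrator (2 ^ m) G ins outs"
  using butterfly_pair_concentrator[OF assms(1)] by simp

end
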